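(* Let $N \ge 2$, $W>0$, $\eta>0$, and let $P_{\mathrm{out}}$ and $\tilde P_{\mathrm{out}}^{(K)}$, $1\le K\le N$, be as defined in the context. For all $\gamma_{\mathrm{th}}>0$ and $\bar\gamma>0$, the truncated outage probability is monotonically non-increasing in $K$: $$\tilde P_{\mathrm{out}}^{(1)} \ge \tilde P_{\mathrm{out}}^{(2)} \ge \cdots \ge \tilde P_{\mathrm{out}}^{(N)} = P_{\mathrm{out}}.$$
   Context: $\mathbf{R}$ is the $N\times N$ real symmetric positive semidefinite Toeplitz matrix (Jakes correlation matrix) with entries $[\mathbf{R}]_{k,l} = J_0\!\left(\frac{2\pi |k-l| W}{N-1}\right)$, where $J_0$ is the zeroth-order Bessel function of the first kind; so $[\mathbf{R}]_{n,n}=1$. Fix an eigendecomposition $\mathbf{R} = \mathbf{U}\boldsymbol{\Lambda}\mathbf{U}^H$ with $\mathbf{U}=[\mathbf{u}_1,\dots,\mathbf{u}_N]$ unitary with entries $u_{n,k}$, and $\boldsymbol{\Lambda}=\mathrm{diag}(\lambda_1,\dots,\lambda_N)$, $\lambda_1\ge\cdots\ge\lambda_N\ge 0$. Let $z_1,\dots,z_N$ be i.i.d. $\mathcal{CN}(0,1)$ (standard circularly symmetric complex Gaussian). The channel vector is $\mathbf{g} = (g_1,\dots,g_N)^T$ with $g_n = \sqrt{\eta}\sum_{k=1}^N \sqrt{\lambda_k}\,u_{n,k} z_k$, so $\mathbf{g}\sim\mathcal{CN}(\mathbf 0,\eta\mathbf{R})$. Its $K$-truncated Karhunen-Loève expansion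 is $\tilde{\mathbf{g}}^{(K)} = (\tilde g_1^{(K)},\dots,\tilde g_N^{(K)})^T$ with $\tilde g_n^{(K)} = \sqrt{\eta}\sum_{k=1}^K \sqrt{\lambda_k}\,u_{n,k} z_k$. Define $F_{\max}(x) = \mathbb{P}(\max_{1\le n\le N} |g_n|^2/\eta \le x)$ and $\tilde F_{\max}^{(K)}(x) = \mathbb{P}(\max_{1\le n\le N} |\tilde g_n^{(K)}|^2/\eta \le x)$. For an SNR threshold $\gamma_{\mathrm{th}}>0$ and average SNR $\bar\gamma>0$, the outage probabilities are $P_{\mathrm{out}} = F_{\max}(\gamma_{\mathrm{th}}/\bar\gamma)$ and $\tilde P_{\mathrm{out}}^{(K)} = \tilde F_{\max}^{(K)}(\gamma_{\mathrm{th}}/\bar\gamma)$. *)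

theory Defs
  imports "HOL-Probability.Probability" "Jordan_Normal_Form.Schur_Decomposition"
begin

text \<open>
  Vectors and matrices are those of \<^theory>\<open>Jordan_Normal_Form.Matrix\<close>, so all indices run
  from 0: port \<open>n\<close> in \<open>{1..N}\<close> is index \<open>n - 1\<close> in \<open>{..<N}\<close>, and likewise for the eigenvalues and
  the variables \<open>z\<close>.  The notation \<open>$\<close> of HOL-Analysis for finite Cartesian products is removed
  because it clashes.
\<close>

no_notation Finite_Cartesian_Product.vec_nth (infixl \<open>$\<close> 90)

text \<open>The Bessel function of the first kind of order 0, by its (everywhere convergent) power series.\<close>

definition bessel_J0 :: "real \<Rightarrow> real" where
  "bessel_J0 x = (\<Sum>m. (- 1) ^ m / (fact m)\<^sup>2 * (x / 2) ^ (2 * m))"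

lemma summable_bessel_J0:
  "summable (\<lambda>m. (- 1) ^ m / (fact m)\<^sup>2 * (x / 2) ^ (2 * m) :: real)"
proof (rule summable_comparison_test')
  show "summable (\<lambda>m. inverse (fact m) * ((x / 2)\<^sup>2) ^ m :: real)"
    by (rule summable_exp)
  fix m :: nat assume "m \<ge> 0"
  have "(fact m :: real) * 1 \<le> fact m * fact m"
    by (rule mult_left_mono) (rule fact_ge_1, rule fact_ge_zero)
  then have le: "inverse ((fact m :: real)\<^sup>2) \<le> inverse (fact m)"
    by (intro le_imp_inverse_le) (simp_all only: power2_eq_square mult_1_right fact_gt_zero)
  have "norm ((- 1) ^ m / (fact m)\<^sup>2 * (x / 2) ^ (2 * m) :: real)
      = inverse ((fact m)\<^sup>2) * ((x / 2)\<^sup>2) ^ m"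
  proof -
    have "norm (s / f\<^sup>2 * p ^ m) = inverse (f\<^sup>2) * p ^ m" if "\<bar>s\<bar> = 1" "p \<ge> 0" for s f p :: real
      using that by (simp add: abs_mult divide_inverse)
    from this[of "(- 1) ^ m" "(x / 2)\<^sup>2" "fact m"] show ?thesis
      unfolding power_mult[of "x / 2"] by (simp only: power_abs abs_minus_cancel abs_one power_one
          zero_le_power2 simp_thms)
  qed
  also have "\<dots> \<le> inverse (fact m) * ((x / 2)\<^sup>2) ^ m"
    using le by (rule mult_right_mono) (rule zero_le_power, rule zero_le_power2)
  finally show "norm ((- 1) ^ m / (fact m)\<^sup>2 * (x / 2) ^ (2 * m) :: real)
      \<le> inverse (fact m) * ((x / 2)\<^sup>2) ^ m" .
qed

lemma bessel_J0_0 [simp]: "bessel_J0 0 = 1"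
proof -
  have "(\<lambda>m. (- 1) ^ m / (fact m)\<^sup>2 * (0 / 2) ^ (2 * m) :: real) = (\<lambda>m. if m = 0 then 1 else 0)"
    by (rule ext) (auto simp: zero_power)
  then show ?thesis
    unfolding bessel_J0_def by (simp only: sums_unique[OF sums_single[of 0 "\<lambda>_. 1::real"], symmetric])
qed

definition jakes_matrix :: "nat \<Rightarrow> real \<Rightarrow> real mat" where
  "jakes_matrix N W =
     Matrix.mat N N (\<lambda>(k, l). bessel_J0 (2 * pi * \<bar>real k - real l\<bar> * W / (real N - 1)))"

definition unitary_mat :: "nat \<Rightarrow> complex mat \<Rightarrow> bool" where
  "unitary_mat N U \<longleftrightarrow>
     U \<in> carrier_mat N N \<and> mat_adjoint U * U = 1\<^sub>m N \<and> U * mat_adjoint U = 1\<^sub>m N"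

text \<open>
  \<open>eigendecomposition N R U lam\<close> says that \<open>R\<close>, viewed as a complex matrix, equals
  \<open>U diag(lam 0, \<dots>, lam (N - 1)) U\<^sup>H\<close> with nonnegative eigenvalues in nonincreasing order.
  Nonnegativity is the positive semidefiniteness of \<open>R\<close>.
\<close>

definition eigendecomposition :: "nat \<Rightarrow> real mat \<Rightarrow> complex mat \<Rightarrow> (nat \<Rightarrow> real) \<Rightarrow> bool" where
  "eigendecomposition N R U lam \<longleftrightarrow>
     unitary_mat N U \<and>
     map_mat complex_of_real R =
       U * mat_diag N (\<lambda>k. complex_of_real (lam k)) * mat_adjoint U \<and>
     (\<forall>k l. k \<le> l \<longrightarrow> l < N \<longrightarrow> lam l \<le> lam k) \<and>
     (\<forall>k<N. 0 \<le> lam k)"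

text \<open>
  The density of the standard circularly symmetric complex Gaussian (real and imaginary parts
  independent with variance \<open>1/2\<close>) with respect to the area measure on the complex plane.
\<close>

definition std_complex_normal_density :: "complex \<Rightarrow> real" where
  "std_complex_normal_density w = exp (- (cmod w)\<^sup>2) / pi"

definition iid_std_complex_normal :: "'a measure \<Rightarrow> nat \<Rightarrow> (nat \<Rightarrow> 'a \<Rightarrow> complex) \<Rightarrow> bool" where
  "iid_std_complex_normal M N z \<longleftrightarrow>
     prob_space.indep_vars M (\<lambda>_. borel) z {..<N} \<and>
     (\<forall>k<N. distributed M lborel (z k) (\<lambda>w. ennreal (std_complex_normal_density w)))"

definition channel ::
    "nat \<Rightarrow> real \<Rightarrow> complex mat \<Rightarrow> (nat \<Rightarrow> real) \<Rightarrow> (nat \<Rightarrow> 'a \<Rightarrow> complex) \<Rightarrow> 'a \<Rightarrow> complex Matrix.vec"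
  where
  "channel N \<eta> U lam z \<omega> =
     Matrix.vec N (\<lambda>n. complex_of_real (sqrt \<eta>) *
       (\<Sum>k<N. complex_of_real (sqrt (lam k)) * U $$ (n, k) * z k \<omega>))"

definition truncated_channel ::
    "nat \<Rightarrow> real \<Rightarrow> complex mat \<Rightarrow> (nat \<Rightarrow> real) \<Rightarrow> (nat \<Rightarrow> 'a \<Rightarrow> complex) \<Rightarrow> nat \<Rightarrow> 'a \<Rightarrow> complex Matrix.vec"
  where
  "truncated_channel N \<eta> U lam z K \<omega> =
     Matrix.vec N (\<lambda>n. complex_of_real (sqrt \<eta>) *
       (\<Sum>k<K. complex_of_real (sqrt (lam k)) * U $$ (n, k) * z k \<omega>))"

text \<open>
  The distribution function of the largest normalised gain of a random vector \<open>g\<close> of dimension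
  \<open>N \<ge> 1\<close>: \<open>F\<^sub>m\<^sub>a\<^sub>x\<close> for \<open>channel\<close>, and its truncated version for \<open>truncated_channel\<close>.
\<close>

definition F_max :: "'a measure \<Rightarrow> nat \<Rightarrow> real \<Rightarrow> ('a \<Rightarrow> complex Matrix.vec) \<Rightarrow> real \<Rightarrow> real" where
  "F_max M N \<eta> g x =
     measure M {\<omega> \<in> space M. Max ((\<lambda>n. (cmod (g \<omega> $ n))\<^sup>2 / \<eta>) ` {..<N}) \<le> x}"

definition P_out ::
    "'a measure \<Rightarrow> nat \<Rightarrow> real \<Rightarrow> ('a \<Rightarrow> complex Matrix.vec) \<Rightarrow> real \<Rightarrow> real \<Rightarrow> real" where
  "P_out M N \<eta> g \<gamma>th \<gamma>bar = F_max M N \<eta> g (\<gamma>th / \<gamma>bar)"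

end

theory Submission
  imports Defs
begin

text \<open>
  Adding the term \<open>K + 1\<close> of the expansion translates the truncated channel by a random multiple
  of a fixed vector, and the outage event is membership in a symmetric convex set. By Anderson's
  inequality every translation lowers the Gaussian probability of such a set: the probability
  \<open>\<Phi>(w)\<close> that the vector translated by the multiple \<open>w\<close> lies in the set is even in \<open>w\<close> and, as a
  marginal of a log-concave function, log-concave, so that \<open>\<Phi>(w)\<^sup>2 = \<Phi>(w) \<Phi>(- w) \<le> \<Phi>(0)\<^sup>2\<close>.
  Log-concavity of marginals is the Prekopa-Leindler inequality; its midpoint case suffices, and
  it reduces by Fubini to dimension one, where it is the Brunn-Minkowski inequality applied to
  superlevel sets.
\<close>

section \<open>The Prekopa-Leindler inequality\<close>

lemma emeasure_lborel_translate:
  fixes A :: "real set"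
  assumes [measurable]: "A \<in> sets borel"
  shows "emeasure lborel {x. x - b \<in> A} = emeasure lborel A"
proof -
  have "emeasure lborel A = (\<integral>\<^sup>+x. indicator A (- b + 1 * x) \<partial>lborel)"
    using nn_integral_real_affine[of "indicator A" 1 "- b"] by simp
  also have "\<dots> = (\<integral>\<^sup>+x. indicator {x. x - b \<in> A} x \<partial>lborel)"
    by (intro nn_integral_cong) (auto simp: indicator_def)
  also have "\<dots> = emeasure lborel {x. x - b \<in> A}"
    by (subst nn_integral_indicator) auto
  finally show ?thesis by simp
qed

lemma emeasure_lborel_double:
  fixes A :: "real set"
  assumes [measurable]: "A \<in> sets borel"
  shows "emeasure lborel {x. x / 2 \<in> A} = 2 * emeasure lborel A"
proof -
  have "emeasure lborel {x. x / 2 \<in> A} = (\<integral>\<^sup>+x. indicator {x. x / 2 \<in> A} x \<partial>lborel)"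
    by (subst nn_integral_indicator) auto
  also have "\<dots> = 2 * (\<integral>\<^sup>+x. indicator {x. x / 2 \<in> A} (0 + 2 * x) \<partial>lborel)"
    by (subst nn_integral_real_affine[of _ 2 0]) auto
  also have "(\<integral>\<^sup>+x. indicator {x. x / 2 \<in> A} (0 + 2 * x) \<partial>lborel) = emeasure lborel A"
    by (subst nn_integral_indicator[symmetric]) (auto intro!: nn_integral_cong simp: indicator_def simp del: nn_integral_indicator)
  finally show ?thesis .
qed

text \<open>Take \<open>a\<close> nearly maximal in \<open>A\<close> and \<open>b\<close> nearly
  minimal in \<open>B\<close>. Then \<open>A + b\<close> lies almost to the left of
  \<open>a + b\<close> and \<open>B + a\<close> almost to the right, and both lie in the doubled set
  \<open>C\<close>, so their lengths add up to a small error. \<open>C\<close> is any Borel set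
  containing the midpoints, because the sum of two Borel sets need not be Borel.\<close>

lemma brunn_minkowski_real:
  fixes A B C :: "real set"
  assumes [measurable]: "A \<in> sets borel" "B \<in> sets borel" "C \<in> sets borel"
    and "A \<noteq> {}" "B \<noteq> {}" "bdd_above A" "bdd_below B"
    and C: "\<And>x y. x \<in> A \<Longrightarrow> y \<in> B \<Longrightarrow> midpoint x y \<in> C"
  shows "emeasure lborel A + emeasure lborel B \<le> 2 * emeasure lborel C"
proof (rule ennreal_le_epsilon)
  fix e :: real assume e: "0 < e"
  obtain a where a: "a \<in> A" "Sup A - e / 2 < a"
    using less_cSupD[of A "Sup A - e / 2"] assms e by auto
  obtain b where b: "b \<in> B" "b < Inf B + e / 2"
    using cInf_lessD[of B "Inf B + e / 2"] assms e by auto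
  txt \<open>Translates of \<open>A\<close> and \<open>B\<close> contained in \<open>A + B\<close> that overlap in an interval of length at most \<open>e\<close>.\<close>
  define X Y D where "X = {x. x - b \<in> A}" and "Y = {x. x - a \<in> B}" and "D = {x. x / 2 \<in> C}"
  have [measurable]: "X \<in> sets borel" "Y \<in> sets borel" "D \<in> sets borel"
    by (simp_all add: X_def Y_def D_def)
  have "X \<union> Y \<subseteq> D"
  proof
    fix x assume "x \<in> X \<union> Y"
    then show "x \<in> D"
    proof
      assume "x \<in> X"
      with C[of "x - b" b] b show ?thesis by (simp add: X_def D_def midpoint_def)
    next
      assume "x \<in> Y"
      with C[of a "x - a"] a show ?thesis by (simp add: Y_def D_def midpoint_def)
    qed
  qed
  \<comment> \<open>\<open>a\<close> and \<open>b\<close> each miss their extremum by less than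
    \<open>e / 2\<close>, so these bounds enclose an interval shorter than \<open>e\<close>.\<close>
  have *: "Inf B + a \<le> x \<and> x \<le> Sup A + b" if "x \<in> X \<inter> Y" for x
    using that cInf_lower[of "x - a" B] cSup_upper[of "x - b" A] assms
    by (auto simp: X_def Y_def)
  have "emeasure lborel (X \<inter> Y) \<le> emeasure lborel {Inf B + a .. Sup A + b}"
    using * by (intro emeasure_mono) auto
  also have "\<dots> \<le> ennreal e"
    using a b e by (cases "Inf B + a \<le> Sup A + b") (auto intro!: ennreal_leI)
  finally have I: "emeasure lborel (X \<inter> Y) \<le> ennreal e" .
  have "emeasure lborel A + emeasure lborel B = emeasure lborel X + emeasure lborel Y"
    by (simp add: X_def Y_def emeasure_lborel_translate)
  also have "\<dots> = emeasure lborel (X \<union> Y) + emeasure lborel (X \<inter> Y)"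
    by (intro emeasure_Un_Int) auto
  also have "\<dots> \<le> emeasure lborel D + ennreal e"
    using \<open>X \<union> Y \<subseteq> D\<close> I by (intro add_mono emeasure_mono) auto
  also have "emeasure lborel D = 2 * emeasure lborel C"
    unfolding D_def by (rule emeasure_lborel_double) simp
  finally show "emeasure lborel A + emeasure lborel B \<le> 2 * emeasure lborel C + ennreal e" .
qed

section \<open>The Prekopa-Leindler inequality on the real line\<close>

lemma nn_integral_layer_cake:
  fixes f :: "'a \<Rightarrow> ennreal"
  assumes "sigma_finite_measure M" and [measurable]: "f \<in> borel_measurable M"
  shows "(\<integral>\<^sup>+x. f x \<partial>M)
    = (\<integral>\<^sup>+t. indicator {0<..} t * emeasure M {x \<in> space M. ennreal t < f x} \<partial>lborel)"
proof -
  interpret sigma_finite_measure M by fact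
  interpret pair_sigma_finite M "lborel :: real measure" ..
  \<comment> \<open>A value is the length of the set of positive levels below it; Fubini then
    exchanges levels and points. Levels must be kept positive because \<open>ennreal\<close> sends
    negative reals to 0.\<close>
  have level: "(\<integral>\<^sup>+t. indicator {t. 0 < t \<and> ennreal t < c} t \<partial>lborel) = c" for c :: ennreal
  proof (cases c)
    case (real r)
    have "{t. 0 < t \<and> ennreal t < c} = {0<..<r}"
      using real by (auto simp: ennreal_less_iff)
    then show ?thesis using real by simp
  next
    case top
    then have "{t. 0 < t \<and> ennreal t < c} = {0<..}" by auto
    moreover have "emeasure lborel {0 :: real<..} = \<infinity>"
    proof (rule ccontr)
      assume "emeasure lborel {0 :: real<..} \<noteq> \<infinity>"
      then obtain n :: nat where n: "emeasure lborel {0 :: real<..} < of_nat n"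
        using ennreal_Ex_less_of_nat[of "emeasure lborel {0 :: real<..}"] by (auto simp: less_top)
      have "of_nat n = emeasure lborel {0 :: real<..<real n}" by (simp add: ennreal_of_nat_eq_real_of_nat)
      also have "\<dots> \<le> emeasure lborel {0 :: real<..}" by (intro emeasure_mono) auto
      finally show False using n by simp
    qed
    ultimately show ?thesis using top by simp
  qed
  have "(\<integral>\<^sup>+x. f x \<partial>M) = (\<integral>\<^sup>+x. \<integral>\<^sup>+t. indicator {t. 0 < t \<and> ennreal t < f x} t \<partial>lborel \<partial>M)"
    by (simp add: level)
  also have "\<dots> = (\<integral>\<^sup>+x. \<integral>\<^sup>+t. (if 0 < t \<and> ennreal t < f x then 1 else 0) \<partial>lborel \<partial>M)"
    by (intro nn_integral_cong) (auto simp: indicator_def)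
  also have "\<dots> = (\<integral>\<^sup>+t. \<integral>\<^sup>+x. (if 0 < t \<and> ennreal t < f x then 1 else 0) \<partial>M \<partial>lborel)"
    by (rule Fubini'[symmetric]) measurable
  also have "\<dots> = (\<integral>\<^sup>+t. \<integral>\<^sup>+x. indicator {0<..} t * indicator {x \<in> space M. ennreal t < f x} x \<partial>M \<partial>lborel)"
    by (intro nn_integral_cong) (auto simp: indicator_def)
  also have "\<dots> = (\<integral>\<^sup>+t. indicator {0<..} t * emeasure M {x \<in> space M. ennreal t < f x} \<partial>lborel)"
    by (subst nn_integral_cmult) auto
  finally show ?thesis .
qed

text \<open>Brunn-Minkowski requires nonempty sets. With both suprema equal to 1, the superlevel
  sets of \<open>f\<close> and \<open>g\<close> are nonempty at exactly the same positive levels,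
  those below 1, so it can be applied level by level and integrated by layer cake.\<close>

lemma prekopa_leindler_normalised:
  fixes f g h :: "real \<Rightarrow> ennreal"
  assumes [measurable]: "f \<in> borel_measurable borel" "g \<in> borel_measurable borel" "h \<in> borel_measurable borel"
    and sup: "(SUP x. f x) = 1" "(SUP x. g x) = 1"
    and supp: "\<And>x. f x \<noteq> 0 \<Longrightarrow> \<bar>x\<bar> \<le> r" "\<And>x. g x \<noteq> 0 \<Longrightarrow> \<bar>x\<bar> \<le> r"
    and le: "\<And>x y. f x * g y \<le> (h (midpoint x y))\<^sup>2"
  shows "(\<integral>\<^sup>+x. f x \<partial>lborel) + (\<integral>\<^sup>+x. g x \<partial>lborel) \<le> 2 * (\<integral>\<^sup>+x. h x \<partial>lborel)"
proof -
  let ?L = "\<lambda>f t. emeasure lborel {x :: real. ennreal t < f x}"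
  have cake: "(\<integral>\<^sup>+x. f x \<partial>lborel) = (\<integral>\<^sup>+t. indicator {0<..} t * ?L f t \<partial>lborel)"
    if "f \<in> borel_measurable borel" for f
    using nn_integral_layer_cake[of lborel f] that sigma_finite_lborel by simp
  have pt: "indicator {0<..} t * ?L f t + indicator {0<..} t * ?L g t \<le> 2 * (indicator {0<..} t * ?L h t)" for t :: real
  proof (cases "0 < t \<and> t < 1")
    case True
    have ne: "{x. ennreal t < f x} \<noteq> {}" if "(SUP x. f x) = 1" for f :: "real \<Rightarrow> ennreal"
    proof -
      have "ennreal t < (SUP x. f x)"
        using True that by (simp add: ennreal_less_one_iff)
      then show ?thesis by (auto simp: less_SUP_iff)
    qed
    have bdd: "bdd_above {x. ennreal t < f x}" "bdd_below {x. ennreal t < f x}"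
      if "\<And>x. f x \<noteq> 0 \<Longrightarrow> \<bar>x\<bar> \<le> r" for f
    proof -
      have "{x. ennreal t < f x} \<subseteq> {- r..r}"
      proof
        fix x assume "x \<in> {x. ennreal t < f x}"
        then have "\<bar>x\<bar> \<le> r" by (intro that) auto
        then show "x \<in> {- r..r}" by auto
      qed
      then show "bdd_above {x. ennreal t < f x}" "bdd_below {x. ennreal t < f x}"
        by (auto intro: bdd_above_mono bdd_below_mono)
    qed
    have "?L f t + ?L g t \<le> 2 * ?L h t"
    proof (rule brunn_minkowski_real)
      fix x y assume "x \<in> {x. ennreal t < f x}" "y \<in> {x. ennreal t < g x}"
      \<comment> \<open>One strict factor suffices: \<open>t\<close> is positive and finite, so
        multiplying by it preserves strictness.\<close>
      then have "ennreal t * ennreal t < ennreal t * g y" "ennreal t * g y \<le> f x * g y"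
        using True by (auto intro!: ennreal_mult_strict_left_mono mult_right_mono)
      then have "ennreal t * ennreal t < f x * g y" by (rule less_le_trans)
      also have "\<dots> \<le> (h (midpoint x y))\<^sup>2" by (rule le)
      finally have "(ennreal t)\<^sup>2 < (h (midpoint x y))\<^sup>2" by (simp add: power2_eq_square)
      then show "midpoint x y \<in> {x. ennreal t < h x}"
        using power_mono[of "h (midpoint x y)" "ennreal t" 2] by (auto simp: not_le[symmetric])
    qed (use ne sup bdd supp in auto)
    then show ?thesis using True by simp
  next
    case False
    \<comment> \<open>Levels from 1 on exceed the suprema; levels at or below 0 are removed by the
      indicator.\<close>
    have "?L f t = 0" if "(SUP x. f x) = 1" "0 < t" for f
    proof -
      have "f x \<le> ennreal t" for x
      proof -
        have "f x \<le> 1" using that SUP_upper[of x UNIV f] by simp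
        also have "1 \<le> ennreal t" using False that by simp
        finally show ?thesis .
      qed
      then have "{x. ennreal t < f x} = {}" by (auto simp: not_less)
      then show ?thesis by simp
    qed
    then show ?thesis using sup by (cases "0 < t") auto
  qed
  have "(\<integral>\<^sup>+x. f x \<partial>lborel) + (\<integral>\<^sup>+x. g x \<partial>lborel)
     = (\<integral>\<^sup>+t. indicator {0<..} t * ?L f t + indicator {0<..} t * ?L g t \<partial>lborel)"
    by (subst (1 2) cake) (simp_all add: nn_integral_add)
  also have "\<dots> \<le> (\<integral>\<^sup>+t. 2 * (indicator {0<..} t * ?L h t) \<partial>lborel)"
    by (intro nn_integral_mono pt)
  also have "\<dots> = 2 * (\<integral>\<^sup>+x. h x \<partial>lborel)"
    by (subst (2) cake) (simp_all add: nn_integral_cmult)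
  finally show ?thesis .
qed

text \<open>The inequality of arithmetic and geometric means, which turns the additive bound of the
  normalised case into the multiplicative one.\<close>

lemma ennreal_mult_le_square_of_sum_le:
  fixes x y c :: ennreal
  assumes "x + y \<le> 2 * c"
  shows "x * y \<le> c\<^sup>2"
proof (cases "c = \<infinity>")
  case False
  then obtain c' where c: "c = ennreal c'" "0 \<le> c'" by (cases c) auto
  have "2 * c < \<infinity>" using c by (simp add: ennreal_mult_less_top)
  with assms have "x + y < \<infinity>" by (rule le_less_trans)
  then obtain x' y' where xy: "x = ennreal x'" "0 \<le> x'" "y = ennreal y'" "0 \<le> y'"
    by (cases x; cases y) auto
  have "ennreal (x' + y') \<le> ennreal (2 * c')"
    using assms c xy by (simp add: ennreal_mult)
  then have "x' + y' \<le> 2 * c'" using c by (subst (asm) ennreal_le_iff) auto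
  then have "(x' + y')\<^sup>2 \<le> (2 * c')\<^sup>2" using xy by (intro power_mono) auto
  moreover have "4 * (x' * y') \<le> (x' + y')\<^sup>2"
    using zero_le_power2[of "x' - y'"] by (simp add: power2_eq_square algebra_simps)
  ultimately have "x' * y' \<le> c'\<^sup>2" by (simp add: power_mult_distrib)
  then show ?thesis using c xy by (simp add: ennreal_mult[symmetric] ennreal_power ennreal_leI)
qed (simp add: power2_eq_square)

text \<open>Both sides scale alike: multiplying \<open>f\<close> by \<open>a\<close>,
  \<open>g\<close> by \<open>b\<close> and \<open>h\<close> by \<open>sqrt (a * b)\<close> preserves
  the hypothesis. Choosing \<open>a\<close> and \<open>b\<close> to make the suprema 1 gives the
  normalised case, and the factor \<open>a * b\<close> cancels at the end.\<close>

lemma prekopa_leindler_bounded: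
  fixes f g h :: "real \<Rightarrow> ennreal"
  assumes [measurable]: "f \<in> borel_measurable borel" "g \<in> borel_measurable borel" "h \<in> borel_measurable borel"
    and bnd: "\<And>x. f x \<le> ennreal c" "\<And>x. g x \<le> ennreal c"
    and supp: "\<And>x. f x \<noteq> 0 \<Longrightarrow> \<bar>x\<bar> \<le> r" "\<And>x. g x \<noteq> 0 \<Longrightarrow> \<bar>x\<bar> \<le> r"
    and le: "\<And>x y. f x * g y \<le> (h (midpoint x y))\<^sup>2"
  shows "(\<integral>\<^sup>+x. f x \<partial>lborel) * (\<integral>\<^sup>+x. g x \<partial>lborel) \<le> (\<integral>\<^sup>+x. h x \<partial>lborel)\<^sup>2"
proof (cases "(SUP x. f x) = 0 \<or> (SUP x. g x) = 0")
  case True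
  \<comment> \<open>A vanishing supremum cannot be rescaled to 1, but then the left-hand side is
    0.\<close>
  then have "(\<forall>x. f x = 0) \<or> (\<forall>x. g x = 0)"
    by (metis SUP_upper UNIV_I le_zero_eq)
  then show ?thesis by auto
next
  case False
  have rescale: "\<exists>a>0. ennreal a * (SUP x. f x) = 1"
    if "(SUP x. f x) \<noteq> 0" "\<And>x. f x \<le> ennreal c" for f :: "real \<Rightarrow> ennreal"
  proof -
    have "(SUP x. f x) \<le> ennreal c" using that by (intro SUP_least) auto
    then obtain b where b: "(SUP x. f x) = ennreal b" "0 \<le> b"
      by (cases "SUP x. f x") (auto simp: top_unique)
    with that have "0 < b" by (cases "b = 0") auto
    then have "ennreal (1 / b) * (SUP x. f x) = 1" using b by (simp add: ennreal_mult[symmetric])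
    then show ?thesis using \<open>0 < b\<close> by (intro exI[of _ "1 / b"]) auto
  qed
  obtain a where a: "a > 0" "ennreal a * (SUP x. f x) = 1" using rescale[of f] False bnd by auto
  obtain b where b: "b > 0" "ennreal b * (SUP x. g x) = 1" using rescale[of g] False bnd by auto
  define k where "k = sqrt (a * b)"
  have k: "(ennreal k)\<^sup>2 = ennreal a * ennreal b" "ennreal a * ennreal b \<noteq> 0" "ennreal a * ennreal b \<noteq> \<infinity>"
    using a b by (auto simp: k_def ennreal_power ennreal_mult[symmetric])
  let ?I = "\<lambda>f. (\<integral>\<^sup>+x. f x \<partial>(lborel :: real measure))"
  have "?I (\<lambda>x. ennreal a * f x) + ?I (\<lambda>x. ennreal b * g x) \<le> 2 * ?I (\<lambda>x. ennreal k * h x)"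
  proof (rule prekopa_leindler_normalised[where r = r])
    fix x y
    have "ennreal a * f x * (ennreal b * g y) = (ennreal k)\<^sup>2 * (f x * g y)"
      by (simp add: k mult_ac)
    also have "\<dots> \<le> (ennreal k)\<^sup>2 * (h (midpoint x y))\<^sup>2"
      by (intro mult_left_mono le) auto
    finally show "ennreal a * f x * (ennreal b * g y) \<le> (ennreal k * h (midpoint x y))\<^sup>2"
      by (simp add: power_mult_distrib)
  qed (use a b supp in \<open>auto simp: SUP_mult_left_ennreal\<close>)
  then have "(ennreal a * ?I f) * (ennreal b * ?I g) \<le> (ennreal k * ?I h)\<^sup>2"
    by (intro ennreal_mult_le_square_of_sum_le) (simp add: nn_integral_cmult)
  then have "(ennreal a * ennreal b) * (?I f * ?I g) \<le> (ennreal a * ennreal b) * (?I h)\<^sup>2"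
    by (simp add: power_mult_distrib k mult_ac)
  then show ?thesis using k by (simp add: ennreal_mult_le_mult_iff)
qed

text \<open>The inequality is made a property of the measure so that it can be passed on to products
  and densities. Squaring the side of \<open>h\<close> replaces the square roots of the usual
  midpoint form.\<close>

definition prekopa_leindler :: "'b::{real_vector,topological_space} measure \<Rightarrow> bool" where
  "prekopa_leindler \<mu> \<longleftrightarrow> (\<forall>f\<in>borel_measurable borel. \<forall>g\<in>borel_measurable borel. \<forall>h\<in>borel_measurable borel.
     (\<forall>x y. f x * g y \<le> (h (midpoint x y))\<^sup>2) \<longrightarrow>
     (\<integral>\<^sup>+x. f x \<partial>\<mu>) * (\<integral>\<^sup>+x. g x \<partial>\<mu>) \<le> (\<integral>\<^sup>+x. h x \<partial>\<mu> :: ennreal)\<^sup>2)"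

lemma prekopa_leindlerD:
  assumes "prekopa_leindler \<mu>"
    and "f \<in> borel_measurable borel" "g \<in> borel_measurable borel" "h \<in> borel_measurable borel"
    and "\<And>x y. f x * g y \<le> (h (midpoint x y))\<^sup>2"
  shows "(\<integral>\<^sup>+x. f x \<partial>\<mu>) * (\<integral>\<^sup>+x. g x \<partial>\<mu>) \<le> (\<integral>\<^sup>+x. h x \<partial>\<mu> :: ennreal)\<^sup>2"
  using assms(1)[unfolded prekopa_leindler_def, rule_format, of f g h] assms(2-) by simp

lemma prekopa_leindler_lborel_real: "prekopa_leindler (lborel :: real measure)"
  unfolding prekopa_leindler_def
proof (intro ballI impI)
  fix f g h :: "real \<Rightarrow> ennreal"
  assume [measurable]: "f \<in> borel_measurable borel" "g \<in> borel_measurable borel" "h \<in> borel_measurable borel"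
    and le: "\<forall>x y. f x * g y \<le> (h (midpoint x y))\<^sup>2"
  let ?I = "\<lambda>f. (\<integral>\<^sup>+x. f x \<partial>(lborel :: real measure))"
  txt \<open>Truncation makes the suprema finite and the superlevel sets bounded.\<close>
  define trunc :: "(real \<Rightarrow> ennreal) \<Rightarrow> nat \<Rightarrow> real \<Rightarrow> ennreal"
    where "trunc f n x = (if \<bar>x\<bar> \<le> real n then min (f x) (of_nat n) else 0)" for f n x
  have [measurable]: "trunc f n \<in> borel_measurable borel" if [measurable]: "f \<in> borel_measurable borel" for f n
    unfolding trunc_def[abs_def] by measurable
  have trunc_le: "trunc f n x \<le> f x" for f n x by (simp add: trunc_def)
  have mono: "trunc f m x \<le> trunc f n x" if "m \<le> n" for f m n x
    using that by (auto simp: trunc_def min_le_iff_disj)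
  have SUP_trunc: "(SUP n. trunc f n x) = f x" for f x
  proof (rule antisym)
    show "(SUP n. trunc f n x) \<le> f x" by (intro SUP_least trunc_le)
    show "f x \<le> (SUP n. trunc f n x)"
    \<comment> \<open>Comparing with \<open>y\<close> strictly below \<open>f x\<close> also covers
      an infinite value \<open>f x\<close>, since such a \<open>y\<close> is finite. The index must
      dominate both \<open>y\<close> and the modulus of \<open>x\<close>.\<close>
    proof (rule dense_le)
      fix y assume y: "y < f x"
      then obtain m where m: "y < of_nat m"
        using ennreal_Ex_less_of_nat[of y] by (metis order_less_le_trans top_greatest)
      obtain l :: nat where l: "\<bar>x\<bar> \<le> real l" using real_arch_simple by blast
      have "(of_nat m :: ennreal) \<le> of_nat (max l m)" by (simp only: of_nat_le_iff max.cobounded2)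
      then have "y \<le> of_nat (max l m)" using m by (meson less_imp_le order_trans)
      then have "y \<le> trunc f (max l m) x"
        using y l by (auto simp: trunc_def simp del: of_nat_max)
      also have "\<dots> \<le> (SUP n. trunc f n x)" by (intro SUP_upper) auto
      finally show "y \<le> (SUP n. trunc f n x)" .
    qed
  qed
  have lim: "?I f = (SUP n. ?I (trunc f n))" if [measurable]: "f \<in> borel_measurable borel" for f
  proof -
    have "?I f = ?I (\<lambda>x. SUP n. trunc f n x)" by (simp add: SUP_trunc)
    also have "\<dots> = (SUP n. ?I (trunc f n))"
      by (rule nn_integral_monotone_convergence_SUP) (auto simp: incseq_def le_fun_def mono)
    finally show ?thesis .
  qed
  \<comment> \<open>The truncation indices are independent because a product of two suprema is a
    supremum over pairs. Truncation only lowers \<open>f\<close> and \<open>g\<close>, so the same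
    \<open>h\<close> serves.\<close>
  have bound: "?I (trunc f m) * ?I (trunc g n) \<le> (?I h)\<^sup>2" for m n
  proof (rule prekopa_leindler_bounded[where c = "real (max m n)" and r = "real (max m n)"])
    show "trunc f m x \<le> ennreal (real (max m n))" "trunc g n x \<le> ennreal (real (max m n))" for x
      unfolding ennreal_of_nat_eq_real_of_nat[symmetric]
      by (auto simp: trunc_def min_le_iff_disj simp del: of_nat_max)
    show "trunc f m x \<noteq> 0 \<Longrightarrow> \<bar>x\<bar> \<le> real (max m n)" "trunc g n x \<noteq> 0 \<Longrightarrow> \<bar>x\<bar> \<le> real (max m n)" for x
      by (auto simp: trunc_def split: if_splits)
    show "trunc f m x * trunc g n y \<le> (h (midpoint x y))\<^sup>2" for x y
      using mult_mono[OF trunc_le[of f m x] trunc_le[of g n y]] le by (auto intro: order_trans)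
  qed measurable
  show "?I f * ?I g \<le> (?I h)\<^sup>2"
    unfolding lim[OF \<open>f \<in> _\<close>] lim[OF \<open>g \<in> _\<close>] SUP_mult_left_ennreal SUP_mult_right_ennreal
    by (intro SUP_least bound)
qed

section \<open>Transfer to the complex plane and to log-concave densities\<close>

lemma lborel_complex_eq: "(lborel :: complex measure) = distr (lborel \<Otimes>\<^sub>M lborel) borel (\<lambda>(x, y). Complex x y)"
proof (rule lborel_eqI)
  have [measurable]: "(\<lambda>(x, y). Complex x y) \<in> lborel \<Otimes>\<^sub>M lborel \<rightarrow>\<^sub>M borel"
    unfolding Complex_eq by measurable
  fix l u :: complex assume le: "\<And>b. b \<in> Basis \<Longrightarrow> l \<bullet> b \<le> u \<bullet> b"
  have "(\<lambda>(x, y). Complex x y) -` box l u \<inter> space (lborel \<Otimes>\<^sub>M lborel)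
      = {Re l<..<Re u} \<times> {Im l<..<Im u}"
    by (auto simp: mem_box Basis_complex_def space_pair_measure)
  moreover have "Re l \<le> Re u" "Im l \<le> Im u"
    using le[of 1] le[of \<i>] by (auto simp: Basis_complex_def)
  ultimately show "emeasure (distr (lborel \<Otimes>\<^sub>M lborel) borel (\<lambda>(x, y). Complex x y)) (box l u)
      = (\<Prod>b\<in>Basis. (u - l) \<bullet> b)"
    by (subst emeasure_distr)
      (auto simp: lborel.emeasure_pair_measure_Times Basis_complex_def ennreal_mult)
qed simp

lemma nn_integral_lborel_complex:
  assumes [measurable]: "f \<in> borel_measurable borel"
  shows "(\<integral>\<^sup>+w. f w \<partial>lborel) = (\<integral>\<^sup>+x. \<integral>\<^sup>+y. f (Complex x y) \<partial>lborel \<partial>lborel)"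
proof -
  have [measurable]: "(\<lambda>(x, y). Complex x y) \<in> lborel \<Otimes>\<^sub>M lborel \<rightarrow>\<^sub>M borel"
    unfolding Complex_eq by measurable
  show ?thesis
    unfolding lborel_complex_eq
    by (subst nn_integral_distr) (auto simp: lborel.nn_integral_fst[symmetric])
qed

text \<open>The real inequality is used twice: on vertical slices it shows that the slice integrals
  satisfy the hypothesis in the real part, and a second use integrates over the real part.\<close>

lemma prekopa_leindler_lborel_complex: "prekopa_leindler (lborel :: complex measure)"
  unfolding prekopa_leindler_def
proof (intro ballI impI)
  fix f g h :: "complex \<Rightarrow> ennreal"
  assume [measurable]: "f \<in> borel_measurable borel" "g \<in> borel_measurable borel" "h \<in> borel_measurable borel"
    and le: "\<forall>x y. f x * g y \<le> (h (midpoint x y))\<^sup>2"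
  have [measurable]: "(\<lambda>(x, y). f (Complex x y)) \<in> borel_measurable (borel \<Otimes>\<^sub>M borel)"
    if [measurable]: "f \<in> borel_measurable borel" for f :: "complex \<Rightarrow> ennreal"
    unfolding Complex_eq by measurable
  have mid: "midpoint (Complex a b) (Complex c d) = Complex (midpoint a c) (midpoint b d)" for a b c d
    by (simp add: midpoint_def complex_eq_iff)
  let ?J = "\<lambda>f x. \<integral>\<^sup>+y. f (Complex x y) \<partial>lborel"
  have "(\<integral>\<^sup>+x. ?J f x \<partial>lborel) * (\<integral>\<^sup>+x. ?J g x \<partial>lborel) \<le> (\<integral>\<^sup>+x. ?J h x \<partial>lborel)\<^sup>2"
  proof (rule prekopa_leindlerD[OF prekopa_leindler_lborel_real])
    fix a c
    show "?J f a * ?J g c \<le> (?J h (midpoint a c))\<^sup>2"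
    proof (rule prekopa_leindlerD[OF prekopa_leindler_lborel_real])
      fix b d show "f (Complex a b) * g (Complex c d) \<le> (h (Complex (midpoint a c) (midpoint b d)))\<^sup>2"
        using le unfolding mid[symmetric] by blast
    qed measurable
  qed measurable
  then show "(\<integral>\<^sup>+x. f x \<partial>lborel) * (\<integral>\<^sup>+x. g x \<partial>lborel) \<le> (\<integral>\<^sup>+x. h x \<partial>lborel)\<^sup>2"
    by (simp add: nn_integral_lborel_complex)
qed

text \<open>A midpoint log-concave density can be absorbed into the three functions, since the
  hypotheses on \<open>d\<close> and on \<open>f\<close>, \<open>g\<close>, \<open>h\<close>
  multiply.\<close>

lemma prekopa_leindler_density:
  assumes \<mu>: "prekopa_leindler \<mu>" and sets: "sets \<mu> = sets borel"
    and [measurable]: "d \<in> borel_measurable borel"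
    and d: "\<And>x y. d x * d y \<le> (d (midpoint x y))\<^sup>2"
  shows "prekopa_leindler (density \<mu> d)"
  unfolding prekopa_leindler_def
proof (intro ballI impI)
  note [measurable_cong] = sets
  fix f g h :: "'a \<Rightarrow> ennreal"
  assume [measurable]: "f \<in> borel_measurable borel" "g \<in> borel_measurable borel" "h \<in> borel_measurable borel"
    and le: "\<forall>x y. f x * g y \<le> (h (midpoint x y))\<^sup>2"
  have "(\<integral>\<^sup>+x. d x * f x \<partial>\<mu>) * (\<integral>\<^sup>+x. d x * g x \<partial>\<mu>) \<le> (\<integral>\<^sup>+x. d x * h x \<partial>\<mu>)\<^sup>2"
  proof (rule prekopa_leindlerD[OF \<mu>])
    fix x y
    have "d x * f x * (d y * g y) = (d x * d y) * (f x * g y)" by (simp add: mult_ac)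
    also have "\<dots> \<le> (d (midpoint x y))\<^sup>2 * (h (midpoint x y))\<^sup>2"
      using d le by (intro mult_mono) auto
    finally show "d x * f x * (d y * g y) \<le> (d (midpoint x y) * h (midpoint x y))\<^sup>2"
      by (simp add: power_mult_distrib)
  qed measurable
  then show "(\<integral>\<^sup>+x. f x \<partial>density \<mu> d) * (\<integral>\<^sup>+x. g x \<partial>density \<mu> d) \<le> (\<integral>\<^sup>+x. h x \<partial>density \<mu> d)\<^sup>2"
    by (simp add: nn_integral_density)
qed

section \<open>Marginals of log-concave functions\<close>

definition midpoint_log_concave :: "(('i \<Rightarrow> 'b::real_vector) \<Rightarrow> ennreal) \<Rightarrow> bool" where
  "midpoint_log_concave F \<longleftrightarrow> (\<forall>s t. F s * F t \<le> (F (\<lambda>i. midpoint (s i) (t i)))\<^sup>2)"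

lemma ennreal_power2_le_imp_le:
  fixes x y :: ennreal
  assumes "x\<^sup>2 \<le> y\<^sup>2"
  shows "x \<le> y"
proof (cases x; cases y)
  fix x' y' assume xy: "x = ennreal x'" "0 \<le> x'" "y = ennreal y'" "0 \<le> y'"
  with assms have "x'\<^sup>2 \<le> y'\<^sup>2" by (simp add: ennreal_power)
  with xy show ?thesis by (auto intro!: ennreal_leI power2_le_imp_le)
qed (use assms in \<open>auto simp: ennreal_power top_unique power_eq_top_ennreal\<close>)

section \<open>Integrating out coordinates of a product measure\<close>

lemma measurable_override_on:
  assumes f: "\<And>i. (\<lambda>\<omega>. f \<omega> i) \<in> N \<rightarrow>\<^sub>M borel"
    and g: "\<And>i. i \<in> I \<Longrightarrow> (\<lambda>\<omega>. g \<omega> i) \<in> N \<rightarrow>\<^sub>M borel"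
  shows "(\<lambda>\<omega>. override_on (f \<omega>) (g \<omega>) I) \<in> N \<rightarrow>\<^sub>M PiM UNIV (\<lambda>_. borel)"
proof -
  have "(\<lambda>\<omega> i. if i \<in> I then g \<omega> i else f \<omega> i) \<in> N \<rightarrow>\<^sub>M PiM UNIV (\<lambda>_. borel)"
  proof (rule measurable_PiM_single')
    show "(\<lambda>\<omega>. if i \<in> I then g \<omega> i else f \<omega> i) \<in> N \<rightarrow>\<^sub>M borel" for i
      using f g by (cases "i \<in> I") simp_all
  qed auto
  then show ?thesis by (simp add: override_on_def[abs_def])
qed

text \<open>
  \<open>PiM I (\<lambda>_. \<mu>)\<close> lives on functions that are \<open>undefined\<close> outside \<open>I\<close>; overriding a total
  function \<open>s\<close> makes the coordinates outside \<open>I\<close> free parameters.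
\<close>

definition partial_integral ::
    "'b measure \<Rightarrow> 'i set \<Rightarrow> (('i \<Rightarrow> 'b) \<Rightarrow> ennreal) \<Rightarrow> ('i \<Rightarrow> 'b) \<Rightarrow> ennreal" where
  "partial_integral \<mu> I F s = (\<integral>\<^sup>+x. F (override_on s x I) \<partial>PiM I (\<lambda>_. \<mu>))"

context
  fixes \<mu> :: "'b::{real_vector,topological_space} measure" and F :: "('i \<Rightarrow> 'b) \<Rightarrow> ennreal"
  assumes \<mu>: "sigma_finite_measure \<mu>" "sets \<mu> = sets borel"
    and F: "F \<in> borel_measurable (PiM UNIV (\<lambda>_. borel))"
begin

interpretation sigma_finite_measure \<mu> by (rule \<mu>)

interpretation product_sigma_finite "\<lambda>_ :: 'i. \<mu>" ..

declare \<mu>(2) [measurable_cong]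

lemma partial_integral_empty: "partial_integral \<mu> {} F s = F s"
  by (simp add: partial_integral_def PiM_empty nn_integral_count_space_finite)

lemma measurable_partial_integral:
  assumes "finite I"
  shows "(\<lambda>y. partial_integral \<mu> I F (s(j := y))) \<in> borel_measurable \<mu>"
proof -
  interpret I: sigma_finite_measure "PiM I (\<lambda>_. \<mu>)" by (rule sigma_finite[OF assms])
  have "(\<lambda>p. override_on (s(j := fst p)) (snd p) I) \<in> \<mu> \<Otimes>\<^sub>M PiM I (\<lambda>_. \<mu>) \<rightarrow>\<^sub>M PiM UNIV (\<lambda>_. borel)"
    by (intro measurable_override_on) (auto simp: fun_upd_def)
  from measurable_compose[OF this F]
  have [measurable]: "(\<lambda>(y, x). F (override_on (s(j := y)) x I)) \<in> borel_measurable (\<mu> \<Otimes>\<^sub>M PiM I (\<lambda>_. \<mu>))"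
    by (simp add: split_beta')
  show ?thesis unfolding partial_integral_def by measurable
qed

lemma partial_integral_insert:
  assumes "finite I" "j \<notin> I"
  shows "partial_integral \<mu> (insert j I) F s = (\<integral>\<^sup>+y. partial_integral \<mu> I F (s(j := y)) \<partial>\<mu>)"
proof -
  have "(\<lambda>x. override_on s x (insert j I)) \<in> PiM (insert j I) (\<lambda>_. \<mu>) \<rightarrow>\<^sub>M PiM UNIV (\<lambda>_. borel)"
    by (intro measurable_override_on) auto
  from measurable_compose[OF this F]
  have "partial_integral \<mu> (insert j I) F s
      = (\<integral>\<^sup>+y. \<integral>\<^sup>+x. F (override_on s (x(j := y)) (insert j I)) \<partial>PiM I (\<lambda>_. \<mu>) \<partial>\<mu>)"
    unfolding partial_integral_def by (intro product_nn_integral_insert_rev assms)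
  \<comment> \<open>As \<open>j\<close> lies outside \<open>I\<close>, overriding on
    \<open>I\<close> leaves the value \<open>y\<close> at \<open>j\<close> intact.\<close>
  moreover have "override_on s (x(j := y)) (insert j I) = override_on (s(j := y)) x I" for x y
    using assms by (auto simp: override_on_def fun_eq_iff)
  ultimately show ?thesis by (simp add: partial_integral_def)
qed

text \<open>Coordinates are integrated out one at a time. The induction hypothesis, read along
  coordinate \<open>j\<close>, is precisely the hypothesis of Prekopa-Leindler for the next
  integration.\<close>

lemma midpoint_log_concave_partial_integral:
  assumes "prekopa_leindler \<mu>" "midpoint_log_concave F" "finite I"
  shows "midpoint_log_concave (partial_integral \<mu> I F)"
  using \<open>finite I\<close>
proof induction
  case empty
  then show ?case using assms by (simp add: partial_integral_empty[abs_def])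
next
  case (insert j I)
  have meas: "(\<lambda>y. partial_integral \<mu> I F (s(j := y))) \<in> borel_measurable borel" for s
    using measurable_partial_integral[OF insert(1)] \<mu>(2) by (simp cong: measurable_cong_sets)
  show ?case
    unfolding midpoint_log_concave_def partial_integral_insert[OF insert(1,2)]
  proof (intro allI prekopa_leindlerD[OF assms(1)] meas)
    fix s t x y
    have "partial_integral \<mu> I F (s(j := x)) * partial_integral \<mu> I F (t(j := y))
        \<le> (partial_integral \<mu> I F (\<lambda>i. midpoint ((s(j := x)) i) ((t(j := y)) i)))\<^sup>2"
      using insert(3) unfolding midpoint_log_concave_def by blast
    also have "(\<lambda>i. midpoint ((s(j := x)) i) ((t(j := y)) i)) = (\<lambda>i. midpoint (s i) (t i))(j := midpoint x y)"
      by auto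
    finally show "partial_integral \<mu> I F (s(j := x)) * partial_integral \<mu> I F (t(j := y))
        \<le> (partial_integral \<mu> I F ((\<lambda>i. midpoint (s i) (t i))(j := midpoint x y)))\<^sup>2" .
  qed
qed

text \<open>The symmetry of \<mu> allows each integrated coordinate to be reflected along with the
  free ones; once all are reflected, the evenness of \<open>F\<close> removes the signs.\<close>

lemma partial_integral_uminus:
  assumes sym: "\<And>f. f \<in> borel_measurable borel \<Longrightarrow> (\<integral>\<^sup>+x. f (- x) \<partial>\<mu>) = (\<integral>\<^sup>+x. f x \<partial>\<mu>)"
    and even: "\<And>s. F (\<lambda>i. - s i) = F s" and "finite I"
  shows "partial_integral \<mu> I F (\<lambda>i. - s i) = partial_integral \<mu> I F s"
  using \<open>finite I\<close>
proof (induction arbitrary: s)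
  case empty
  then show ?case using even by (simp add: partial_integral_empty)
next
  case (insert j I)
  have meas: "(\<lambda>y. partial_integral \<mu> I F (s(j := y))) \<in> borel_measurable borel" for s
    using measurable_partial_integral[OF insert(1)] \<mu>(2) by (simp cong: measurable_cong_sets)
  have "partial_integral \<mu> (insert j I) F (\<lambda>i. - s i)
      = (\<integral>\<^sup>+y. partial_integral \<mu> I F ((\<lambda>i. - s i)(j := y)) \<partial>\<mu>)"
    by (rule partial_integral_insert[OF insert(1,2)])
  also have "\<dots> = (\<integral>\<^sup>+y. partial_integral \<mu> I F ((\<lambda>i. - s i)(j := - y)) \<partial>\<mu>)"
    by (rule sym[OF meas, symmetric])
  also have "\<dots> = (\<integral>\<^sup>+y. partial_integral \<mu> I F (\<lambda>i. - (s(j := y)) i) \<partial>\<mu>)"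
    by (intro nn_integral_cong arg_cong[where f = "partial_integral \<mu> I F"]) auto
  also have "\<dots> = partial_integral \<mu> (insert j I) F s"
    by (simp only: insert.IH partial_integral_insert[OF insert(1,2)])
  finally show ?case .
qed

text \<open>Anderson's inequality averaged over the shift: fixing coordinate \<open>j\<close> at
  \<open>y\<close> instead of 0 never increases the integral over \<open>I\<close>, and averaging
  over \<open>y\<close> with total mass 1 keeps the bound.\<close>

lemma partial_integral_insert_le:
  assumes "prob_space \<mu>" "prekopa_leindler \<mu>" "midpoint_log_concave F"
    and sym: "\<And>f. f \<in> borel_measurable borel \<Longrightarrow> (\<integral>\<^sup>+x. f (- x) \<partial>\<mu>) = (\<integral>\<^sup>+x. f x \<partial>\<mu>)"
    and even: "\<And>s. F (\<lambda>i. - s i) = F s" and "finite I" "j \<notin> I"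
  shows "partial_integral \<mu> (insert j I) F (\<lambda>_. 0) \<le> partial_integral \<mu> I F (\<lambda>_. 0)"
proof -
  interpret prob_space \<mu> by fact
  let ?\<Phi> = "partial_integral \<mu> I F"
  have "?\<Phi> ((\<lambda>_. 0)(j := y)) \<le> ?\<Phi> (\<lambda>_. 0)" for y
  proof -
    let ?s = "(\<lambda>_. 0)(j := y)"
    have "(?\<Phi> ?s)\<^sup>2 = ?\<Phi> ?s * ?\<Phi> (\<lambda>i. - ?s i)"
      using partial_integral_uminus[OF sym even \<open>finite I\<close>] by (simp only: power2_eq_square)
    also have "\<dots> \<le> (?\<Phi> (\<lambda>i. midpoint (?s i) (- ?s i)))\<^sup>2"
      using midpoint_log_concave_partial_integral[OF assms(2,3) \<open>finite I\<close>]
      unfolding midpoint_log_concave_def by blast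
    also have "(\<lambda>i. midpoint (?s i) (- ?s i)) = (\<lambda>_. 0)" by (simp add: midpoint_def)
    finally show ?thesis by (rule ennreal_power2_le_imp_le)
  qed
  then have "(\<integral>\<^sup>+y. ?\<Phi> ((\<lambda>_. 0)(j := y)) \<partial>\<mu>) \<le> (\<integral>\<^sup>+y. ?\<Phi> (\<lambda>_. 0) \<partial>\<mu>)"
    by (intro nn_integral_mono)
  then show ?thesis
    using emeasure_space_1 by (simp add: partial_integral_insert[OF assms(6,7)])
qed

end

text \<open>The joint law of an independent subfamily is the product of its marginals. The default
  value 0 outside \<open>I\<close> is what models dropping terms of the expansion.\<close>

lemma (in prob_space) nn_integral_indep_vars:
  fixes z :: "'i \<Rightarrow> 'a \<Rightarrow> 'b::{real_vector,topological_space}"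
  assumes indep: "indep_vars (\<lambda>_. borel) z J" and "I \<subseteq> J" "I \<noteq> {}"
    and distr: "\<And>k. k \<in> I \<Longrightarrow> distr M borel (z k) = \<mu>"
    and F: "F \<in> borel_measurable (PiM UNIV (\<lambda>_. borel))"
  shows "(\<integral>\<^sup>+\<omega>. F (override_on (\<lambda>_. 0) (\<lambda>k. z k \<omega>) I) \<partial>M) = partial_integral \<mu> I F (\<lambda>_. 0)"
proof -
  let ?Z = "\<lambda>\<omega>. \<lambda>k\<in>I. z k \<omega>"
  have indep_I: "indep_vars (\<lambda>_. borel) z I" using indep \<open>I \<subseteq> J\<close> by (rule indep_vars_subset)
  then have rv: "random_variable borel (z k)" if "k \<in> I" for k
    using that by (auto simp: indep_vars_def)
  have "distr M (PiM I (\<lambda>_. borel)) ?Z = PiM I (\<lambda>k. distr M borel (z k))"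
    using indep_vars_iff_distr_eq_PiM'[of I z "\<lambda>_. borel"] indep_I rv \<open>I \<noteq> {}\<close> by simp
  also have "\<dots> = PiM I (\<lambda>_. \<mu>)" by (intro PiM_cong) (auto simp: distr)
  finally have PiM: "PiM I (\<lambda>_. \<mu>) = distr M (PiM I (\<lambda>_. borel)) ?Z" ..
  have [measurable]: "?Z \<in> M \<rightarrow>\<^sub>M PiM I (\<lambda>_. borel)" using rv by (intro measurable_restrict)
  have "(\<lambda>x. override_on (\<lambda>_. 0) x I) \<in> PiM I (\<lambda>_. borel) \<rightarrow>\<^sub>M PiM UNIV (\<lambda>_. borel)"
    by (intro measurable_override_on) auto
  from measurable_compose[OF this F]
  have "partial_integral \<mu> I F (\<lambda>_. 0) = (\<integral>\<^sup>+\<omega>. F (override_on (\<lambda>_. 0) (?Z \<omega>) I) \<partial>M)"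
    unfolding partial_integral_def PiM by (subst nn_integral_distr) auto
  moreover have "override_on (\<lambda>_. 0) (?Z \<omega>) I = override_on (\<lambda>_. 0) (\<lambda>k. z k \<omega>) I" for \<omega>
    by (auto simp: override_on_def fun_eq_iff)
  ultimately show ?thesis by simp
qed

section \<open>The standard complex Gaussian measure\<close>

text \<open>Reflection is the affine map with factor -1, whose Jacobian has modulus 1.\<close>

lemma nn_integral_lborel_uminus:
  fixes f :: "'b::euclidean_space \<Rightarrow> ennreal"
  assumes [measurable]: "f \<in> borel_measurable borel"
  shows "(\<integral>\<^sup>+x. f (- x) \<partial>lborel) = (\<integral>\<^sup>+x. f x \<partial>lborel)"
proof -
  have "(lborel :: 'b measure) = distr lborel borel uminus"
    using lborel_affine[of "-1" "0 :: 'b"] by (simp add: density_1)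
  then have "(\<integral>\<^sup>+x. f x \<partial>lborel) = (\<integral>\<^sup>+x. f x \<partial>distr lborel borel uminus)" by simp
  also have "\<dots> = (\<integral>\<^sup>+x. f (- x) \<partial>lborel)" by (subst nn_integral_distr) auto
  finally show ?thesis ..
qed

definition std_complex_normal :: "complex measure" where
  "std_complex_normal = density lborel (\<lambda>w. ennreal (std_complex_normal_density w))"

lemma std_complex_normal_density_measurable [measurable]: "std_complex_normal_density \<in> borel_measurable borel"
  unfolding std_complex_normal_density_def[abs_def] by measurable

lemma sets_std_complex_normal: "sets std_complex_normal = sets borel"
  by (simp add: std_complex_normal_def)

lemma prekopa_leindler_std_complex_normal: "prekopa_leindler std_complex_normal"
  unfolding std_complex_normal_def
proof (rule prekopa_leindler_density[OF prekopa_leindler_lborel_complex])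
  fix x y :: complex
  have "2 * (cmod (midpoint x y))\<^sup>2 \<le> (cmod x)\<^sup>2 + (cmod y)\<^sup>2"
  proof -
    have "(cmod (midpoint x y))\<^sup>2 = (cmod (x + y))\<^sup>2 / 4"
      by (simp add: midpoint_def power_mult_distrib power2_eq_square)
    \<comment> \<open>The parallelogram law; discarding the square of \<open>cmod (x - y)\<close>
      gives the midpoint convexity of the squared modulus, hence log-concavity of the
      Gaussian.\<close>
    moreover have "(cmod (x + y))\<^sup>2 + (cmod (x - y))\<^sup>2 = 2 * (cmod x)\<^sup>2 + 2 * (cmod y)\<^sup>2"
      by (simp only: cmod_power2) (simp add: power2_eq_square algebra_simps)
    ultimately show ?thesis using zero_le_power2[of "cmod (x - y)"] by linarith
  qed
  then have "exp (- (cmod x)\<^sup>2 - (cmod y)\<^sup>2) \<le> exp (- (2 * (cmod (midpoint x y))\<^sup>2))" by simp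
  then have "std_complex_normal_density x * std_complex_normal_density y
      \<le> (std_complex_normal_density (midpoint x y))\<^sup>2"
    by (simp add: std_complex_normal_density_def power2_eq_square exp_add[symmetric] divide_right_mono)
  moreover have "0 \<le> std_complex_normal_density w" for w by (simp add: std_complex_normal_density_def)
  ultimately show "ennreal (std_complex_normal_density x) * ennreal (std_complex_normal_density y)
      \<le> (ennreal (std_complex_normal_density (midpoint x y)))\<^sup>2"
    by (simp add: ennreal_mult[symmetric] ennreal_power ennreal_leI)
qed simp_all

lemma nn_integral_std_complex_normal_uminus:
  assumes [measurable]: "f \<in> borel_measurable borel"
  shows "(\<integral>\<^sup>+x. f (- x) \<partial>std_complex_normal) = (\<integral>\<^sup>+x. f x \<partial>std_complex_normal)"
proof -
  have "(\<integral>\<^sup>+x. f (- x) \<partial>std_complex_normal)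
      = (\<integral>\<^sup>+x. ennreal (std_complex_normal_density (- x)) * f (- x) \<partial>lborel)"
    by (simp add: std_complex_normal_def nn_integral_density std_complex_normal_density_def)
  also have "\<dots> = (\<integral>\<^sup>+x. ennreal (std_complex_normal_density x) * f x \<partial>lborel)"
    by (rule nn_integral_lborel_uminus) measurable
  finally show ?thesis by (simp add: std_complex_normal_def nn_integral_density)
qed

section \<open>Outage probabilities\<close>

theorem corollary1:
  fixes M :: "'a measure"
    and N :: nat and W \<eta> \<gamma>th \<gamma>bar :: real
    and U :: "complex mat" and lam :: "nat \<Rightarrow> real"
    and z :: "nat \<Rightarrow> 'a \<Rightarrow> complex"
  assumes "N \<ge> 2" and "W > 0" and "\<eta> > 0"
    and "eigendecomposition N (jakes_matrix N W) U lam"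
    and "prob_space M" and "iid_std_complex_normal M N z"
    and "\<gamma>th > 0" and "\<gamma>bar > 0"
  shows "(\<forall>K. 1 \<le> K \<and> K < N \<longrightarrow>
            P_out M N \<eta> (truncated_channel N \<eta> U lam z K) \<gamma>th \<gamma>bar
              \<ge> P_out M N \<eta> (truncated_channel N \<eta> U lam z (K + 1)) \<gamma>th \<gamma>bar)
       \<and> P_out M N \<eta> (truncated_channel N \<eta> U lam z N) \<gamma>th \<gamma>bar
           = P_out M N \<eta> (channel N \<eta> U lam z) \<gamma>th \<gamma>bar"
proof (intro conjI allI impI)
  show "P_out M N \<eta> (truncated_channel N \<eta> U lam z N) \<gamma>th \<gamma>bar
      = P_out M N \<eta> (channel N \<eta> U lam z) \<gamma>th \<gamma>bar"
    by (simp add: channel_def[abs_def] truncated_channel_def[abs_def])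
next
  fix K assume K: "1 \<le> K \<and> K < N"
  interpret prob_space M by fact
  have indep: "indep_vars (\<lambda>_. borel) z {..<N}"
    and dist: "\<And>k. k < N \<Longrightarrow> distributed M lborel (z k) (\<lambda>w. ennreal (std_complex_normal_density w))"
    using \<open>iid_std_complex_normal M N z\<close> by (auto simp: iid_std_complex_normal_def)
  have distr: "distr M borel (z k) = std_complex_normal" if "k < N" for k
    using distributed_distr_eq_density[OF dist[OF that]]
    by (simp add: std_complex_normal_def cong: distr_cong)
  have rv [measurable]: "z k \<in> borel_measurable M" if "k < N" for k
    using distributed_measurable[OF dist[OF that]] by simp
  \<comment> \<open>Total mass 1 is inherited from the law of \<open>z 0\<close>, so no Gaussian
    integral is computed.\<close>
  have prob_normal: "prob_space std_complex_normal"
    using prob_space_distr[of "z 0" borel] distr[of 0] rv[of 0] K by simp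
  then have sigma_finite: "sigma_finite_measure std_complex_normal"
    by (simp add: prob_space_imp_sigma_finite)
  \<comment> \<open>The sum has the \<open>K + 1\<close> indices from 0 to \<open>K\<close>, so one
    function serves both truncations: setting coordinate \<open>K\<close> to 0 gives the shorter
    one.\<close>
  define gain :: "(nat \<Rightarrow> complex) \<Rightarrow> nat \<Rightarrow> complex" where
    "gain s n = complex_of_real (sqrt \<eta>) * (\<Sum>k\<le>K. complex_of_real (sqrt (lam k)) * U $$ (n, k) * s k)" for s n
  define r where "r = sqrt (\<gamma>th / \<gamma>bar * \<eta>)"
  define F :: "(nat \<Rightarrow> complex) \<Rightarrow> ennreal" where
    "F = indicator {s. \<forall>n<N. cmod (gain s n) \<le> r}"
  have gain_mid: "gain (\<lambda>i. midpoint (s i) (t i)) n = midpoint (gain s n) (gain t n)" for s t n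
    by (simp add: gain_def midpoint_def distrib_left sum.distrib scaleR_sum_right[symmetric]
        scaleR_right_distrib)
  have gain_uminus: "gain (\<lambda>i. - s i) n = - gain s n" for s n
    by (simp add: gain_def sum_negf)
  have [measurable]: "(\<lambda>s. gain s n) \<in> borel_measurable (PiM UNIV (\<lambda>_. borel))" for n
    unfolding gain_def by measurable
  have F: "F \<in> borel_measurable (PiM UNIV (\<lambda>_. borel))"
  proof -
    have "{s \<in> space (PiM UNIV (\<lambda>_. borel)). \<forall>n<N. cmod (gain s n) \<le> r} \<in> sets (PiM UNIV (\<lambda>_. borel))"
      by measurable
    then show ?thesis by (simp add: F_def space_PiM)
  qed
  \<comment> \<open>Discs are convex, so the outage set is closed under midpoints; for an indicator
    this is exactly midpoint log-concavity.\<close>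
  have "cmod (midpoint x y) \<le> r" if "cmod x \<le> r" "cmod y \<le> r" for x y
    using that norm_triangle_ineq[of x y] by (simp add: midpoint_def)
  then have lc: "midpoint_log_concave F"
    by (auto simp: midpoint_log_concave_def F_def gain_mid split: split_indicator)
  have P_out_eq: "ennreal (P_out M N \<eta> (truncated_channel N \<eta> U lam z L) \<gamma>th \<gamma>bar)
      = partial_integral std_complex_normal {..<L} F (\<lambda>_. 0)" if L: "1 \<le> L" "L \<le> K + 1" for L
  proof -
    let ?Z = "\<lambda>\<omega>. override_on (\<lambda>_. 0) (\<lambda>k. z k \<omega>) {..<L}"
    have channel: "truncated_channel N \<eta> U lam z L \<omega> $ n = gain (?Z \<omega>) n" if "n < N" for n \<omega>
    proof -
      have "(\<Sum>k\<le>K. complex_of_real (sqrt (lam k)) * U $$ (n, k) * ?Z \<omega> k)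
          = (\<Sum>k<L. complex_of_real (sqrt (lam k)) * U $$ (n, k) * z k \<omega>)"
        using L by (intro sum.mono_neutral_cong_right) auto
      then show ?thesis using that by (simp add: truncated_channel_def gain_def)
    qed
    have le_iff: "(cmod w)\<^sup>2 / \<eta> \<le> \<gamma>th / \<gamma>bar \<longleftrightarrow> cmod w \<le> r" for w
    proof -
      have "(cmod w)\<^sup>2 / \<eta> \<le> \<gamma>th / \<gamma>bar \<longleftrightarrow> (cmod w)\<^sup>2 \<le> \<gamma>th / \<gamma>bar * \<eta>"
        using \<open>\<eta> > 0\<close> by (rule pos_divide_le_eq)
      also have "\<dots> \<longleftrightarrow> cmod w \<le> r"
        unfolding r_def by (metis norm_ge_zero real_le_rsqrt real_sqrt_le_iff real_sqrt_pow2 real_sqrt_abs abs_norm_cancel)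
      finally show ?thesis .
    qed
    \<comment> \<open>The bound on \<open>N\<close> makes the index set nonempty, so
      \<open>Max\<close> is at most the threshold iff every port is.\<close>
    have "{\<omega> \<in> space M. Max ((\<lambda>n. (cmod (truncated_channel N \<eta> U lam z L \<omega> $ n))\<^sup>2 / \<eta>) ` {..<N}) \<le> \<gamma>th / \<gamma>bar}
        = {\<omega> \<in> space M. \<forall>n<N. cmod (gain (?Z \<omega>) n) \<le> r}" (is "?A = ?B")
      using \<open>N \<ge> 2\<close> by (subst Max_le_iff) (auto simp: channel le_iff lessThan_empty_iff)
    then have "ennreal (P_out M N \<eta> (truncated_channel N \<eta> U lam z L) \<gamma>th \<gamma>bar) = emeasure M ?B"
      by (simp add: P_out_def F_max_def emeasure_eq_measure)
    also have "\<dots> = (\<integral>\<^sup>+\<omega>. indicator ?B \<omega> \<partial>M)"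
    proof (rule nn_integral_indicator[symmetric])
      have "?Z \<in> M \<rightarrow>\<^sub>M PiM UNIV (\<lambda>_. borel)"
        using rv L K by (intro measurable_override_on) auto
      then have [measurable]: "(\<lambda>\<omega>. gain (?Z \<omega>) n) \<in> borel_measurable M" for n
        by (rule measurable_compose) measurable
      show "?B \<in> sets M" by measurable
    qed
    also have "\<dots> = (\<integral>\<^sup>+\<omega>. F (?Z \<omega>) \<partial>M)"
      by (intro nn_integral_cong) (auto simp: F_def split: split_indicator)
    also have "\<dots> = partial_integral std_complex_normal {..<L} F (\<lambda>_. 0)"
      using L K distr by (intro nn_integral_indep_vars[OF indep] F) (auto simp: lessThan_empty_iff)
    finally show ?thesis .
  qed
  \<comment> \<open>Counting from 0, the term added in passing from \<open>K\<close> to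
    \<open>K + 1\<close> has index \<open>K\<close>.\<close>
  have "partial_integral std_complex_normal (insert K {..<K}) F (\<lambda>_. 0)
      \<le> partial_integral std_complex_normal {..<K} F (\<lambda>_. 0)"
    using sigma_finite sets_std_complex_normal F prob_normal prekopa_leindler_std_complex_normal lc
      nn_integral_std_complex_normal_uminus
    by (rule partial_integral_insert_le) (auto simp: F_def gain_uminus split: split_indicator)
  then have "ennreal (P_out M N \<eta> (truncated_channel N \<eta> U lam z (K + 1)) \<gamma>th \<gamma>bar)
      \<le> ennreal (P_out M N \<eta> (truncated_channel N \<eta> U lam z K) \<gamma>th \<gamma>bar)"
    using K by (simp add: P_out_eq lessThan_Suc)
  then show "P_out M N \<eta> (truncated_channel N \<eta> U lam z (K + 1)) \<gamma>th \<gamma>bar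
      \<le> P_out M N \<eta> (truncated_channel N \<eta> U lam z K) \<gamma>th \<gamma>bar"
    by (simp add: P_out_def F_max_def)
qed

end
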